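(* Let $P\in\mathcal{P}_n\setminus\{\mathbf{1}_n\}$, let $m=|P|_d$ be the number of $d$'s in $P$, let $k_i$ be the number of $u$'s before the $i$-th $d$ of $P$, and put $\lambda_i=n-i-k_i+1$ for $1\le i\le m$. Then the number of saturated chains from $P$ to $\mathbf{1}_n$ in $\mathcal{P}_n$ is equal to $$\frac{(\lambda_1+\lambda_2+\cdots+\lambda_m)!}{\lambda_1!\,\lambda_2!\cdots\lambda_m!}\prod_{1\le i<j\le m}\frac{\lambda_i-\lambda_j}{\lambda_i+\lambda_j}.$$
   Context: A (binary) path of length $n$ is a word $P=p_1\cdots p_n$ in the letters $u$ (upstep $(1,1)$) and $d$ (downstep $(1,-1)$), viewed as a lattice path starting at the origin. $\mathcal{P}_n$ is the set of paths of length $n$, and $h_i(P)$ is the height ($y$-coordinate) of the $i$-th point of $P$ (after $i$ steps). $\mathcal{P}_n$ is partially ordered by $P\le Q$ iff $h_i(P)\le h_i(Q)$ for all $1\le i\le n$; its maximum element is $\mathbf{1}_n=u^n$. A saturated chain from $P$ to $\mathbf{1}_n$ is a chain $P=P_0<P_1<\cdots<P_r=\mathbf{1}_n$ in which each $P_i$ covers $P_{i-1}$. *)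

theory Defs imports Complex_Main begin

datatype step = Up | Down

fun step_val :: "step \<Rightarrow> int" where
  "step_val Up = 1"
| "step_val Down = -1"

definition paths :: "nat \<Rightarrow> step list set" where
  "paths n = {P. length P = n}"

definition height :: "step list \<Rightarrow> nat \<Rightarrow> int" where
  "height P i = (\<Sum>s\<leftarrow>take i P. step_val s)"

definition path_le :: "nat \<Rightarrow> step list \<Rightarrow> step list \<Rightarrow> bool" where
  "path_le n P Q \<longleftrightarrow> (\<forall>i\<in>{1..n}. height P i \<le> height Q i)"

definition path_less :: "nat \<Rightarrow> step list \<Rightarrow> step list \<Rightarrow> bool" where
  "path_less n P Q \<longleftrightarrow> path_le n P Q \<and> P \<noteq> Q"

definition top_path :: "nat \<Rightarrow> step list" where
  "top_path n = replicate n Up"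

definition covered_by :: "nat \<Rightarrow> step list \<Rightarrow> step list \<Rightarrow> bool" where
  "covered_by n P Q \<longleftrightarrow> P \<in> paths n \<and> Q \<in> paths n \<and> path_less n P Q \<and>
     \<not> (\<exists>R\<in>paths n. path_less n P R \<and> path_less n R Q)"

(* The chain P_0 < P_1 < ... < P_r is encoded as the list [P_0, P_1, ..., P_r]. *)
definition saturated_chains :: "nat \<Rightarrow> step list \<Rightarrow> step list \<Rightarrow> step list list set" where
  "saturated_chains n P Q =
     {c. c \<noteq> [] \<and> set c \<subseteq> paths n \<and> hd c = P \<and> last c = Q \<and>
         (\<forall>i. Suc i < length c \<longrightarrow> covered_by n (c ! i) (c ! Suc i))}"

(* 0-based index in P of its i-th downstep; meaningful for 1 \<le> i \<le> count_list P Down only. *)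
definition down_index :: "step list \<Rightarrow> nat \<Rightarrow> nat" where
  "down_index P i = filter (\<lambda>j. P ! j = Down) [0..<length P] ! (i - 1)"

definition ups_before_down :: "step list \<Rightarrow> nat \<Rightarrow> nat" where
  "ups_before_down P i = count_list (take (down_index P i) P) Up"

end

theory Submission imports Defs begin

text \<open>
  Record a downstep by its depth, one more than the number of steps that follow it; the numbers
  \<open>\<lambda>\<^sub>i\<close> of the theorem are exactly the depths of the downsteps of \<open>P\<close>, in decreasing order.
  Raising a path minimally turns a valley \<open>du\<close> into a peak \<open>ud\<close>, or a final \<open>d\<close> into \<open>u\<close>, so a
  cover lowers one depth by \<open>1\<close>, subject to the depths staying distinct, and a depth that reaches
  \<open>0\<close> disappears (\<open>covered_by_iff_raise\<close>, \<open>down_depths_raise\<close>). A saturated chain from \<open>P\<close> to the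
  top path is therefore a way of emptying a shifted Young diagram with row lengths
  \<open>\<lambda>\<^sub>1 > \<dots> > \<lambda>\<^sub>m\<close> box by box, that is, a standard shifted tableau, and the formula is the classical
  count of those.

  The count and the formula both satisfy the recursion that sums over the parts that can be
  lowered. For the number of chains this is the decomposition by the second element of the chain
  (\<open>saturated_chains_step\<close>). For the formula, almost all factors cancel when the
  recursion (\<open>shifted_tableaux_count_recursion\<close>) is divided by the value at \<open>D\<close> and multiplied by
  \<open>\<Sum>D\<close>, and what remains is

    \<open>(\<Sum>x\<in>D. x * (\<Prod>y\<in>D - {x}. ((x - y - 1) * (x + y)) / ((x + y - 1) * (x - y)))) = (\<Sum>x\<in>D. x)\<close>.

  Parts that cannot be lowered may be included in the sum since their factor \<open>y = x - 1\<close> vanishes.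
  With \<open>a x = x (x - 1)\<close> and \<open>b x = x (x + 1)\<close>, numerator and denominator are \<open>a x - b y\<close> and
  \<open>a x - a y\<close>, and \<open>-2 x = a x - b x\<close>. So the identity is an instance of the evaluation of the
  divided difference of the polynomial \<open>\<Prod>y\<in>D. X - b y\<close> at the nodes \<open>a x\<close>
  (\<open>divdiff_prod_same_degree\<close>).
\<close>

section \<open>Divided differences of products of linear factors\<close>

text \<open>
  This is the divided difference of \<open>f\<close> at the nodes \<open>a i\<close> in Lagrange's explicit form, for
  distinct nodes. Nodes are given as an indexed family because the polynomials of interest have
  roots \<open>b i\<close> indexed by the same set.
\<close>
definition divdiff :: "('i \<Rightarrow> 'a::field) \<Rightarrow> 'i set \<Rightarrow> ('a \<Rightarrow> 'a) \<Rightarrow> 'a" where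
  "divdiff a S f = (\<Sum>i\<in>S. f (a i) / (\<Prod>j\<in>S - {i}. a i - a j))"

lemma divdiff_linear:
  "divdiff a S (\<lambda>x. f x + c * g x) = divdiff a S f + c * divdiff a S g"
  by (simp add: divdiff_def add_divide_distrib sum.distrib sum_distrib_left)

text \<open>
  A factor that vanishes at one node kills the summand of that node and cancels against the
  denominators of all others. Writing \<open>x - b = (x - a k) + (a k - b)\<close>, this
  rule strips linear factors off a polynomial one at a time.
\<close>
lemma divdiff_cancel_node:
  assumes "finite S" "inj_on a S" "k \<in> S"
  shows "divdiff a S (\<lambda>x. (x - a k) * f x) = divdiff a (S - {k}) f"
proof -
  have "divdiff a S (\<lambda>x. (x - a k) * f x)
      = (\<Sum>i\<in>S - {k}. (a i - a k) * f (a i) / (\<Prod>j\<in>S - {i}. a i - a j))"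
    unfolding divdiff_def using assms by (subst sum.remove[of S k]) auto
  also have "\<dots> = divdiff a (S - {k}) f"
    unfolding divdiff_def
  proof (rule sum.cong[OF refl])
    fix i assume i: "i \<in> S - {k}"
    have "a i \<noteq> a k" using i assms by (auto dest: inj_onD)
    moreover have "(\<Prod>j\<in>S - {i}. a i - a j) = (a i - a k) * (\<Prod>j\<in>S - {i} - {k}. a i - a j)"
      using i assms by (intro prod.remove) auto
    moreover have "S - {i} - {k} = S - {k} - {i}" by auto
    ultimately show "(a i - a k) * f (a i) / (\<Prod>j\<in>S - {i}. a i - a j)
        = f (a i) / (\<Prod>j\<in>S - {k} - {i}. a i - a j)" by simp
  qed
  finally show ?thesis .
qed

text \<open>
  For two nodes \<open>k\<close>, \<open>l\<close>, the constant \<open>a l - a k\<close> is \<open>(x - a k) - (x - a l)\<close>; cancelling these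
  factors leaves the divided differences of \<open>1\<close> at two node sets of equal size, which agree by
  induction.
\<close>
lemma divdiff_one:
  fixes a :: "'i \<Rightarrow> 'a::field"
  assumes "finite S" "inj_on a S" "S \<noteq> {}"
  shows "divdiff a S (\<lambda>x. 1) = (if card S = 1 then 1 else 0)"
  using assms
proof (induction "card S" arbitrary: S rule: less_induct)
  case less
  show ?case
  proof (cases "card S = 1")
    case True
    then obtain k where "S = {k}" by (auto simp: card_1_singleton_iff)
    then show ?thesis by (simp add: divdiff_def)
  next
    case False
    obtain k where k: "k \<in> S" using less.prems by auto
    have "S \<noteq> {k}" using False by auto
    then obtain l where l: "l \<in> S" "l \<noteq> k" using k by auto
    have "divdiff a (S - {k}) (\<lambda>x. 1) = divdiff a (S - {l}) (\<lambda>x. 1)"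
    proof -
      have c: "card (S - {k}) < card S" "card (S - {l}) < card S"
        using less.prems k l by (blast intro: card_Diff1_less)+
      have "card (S - {k}) = card (S - {l})" using k l less.prems by simp
      moreover have "inj_on a (S - {k})" "inj_on a (S - {l})"
        using less.prems by (auto intro: inj_on_subset)
      moreover have "S - {k} \<noteq> {}" "S - {l} \<noteq> {}" using k l by auto
      ultimately show ?thesis
        using less.hyps[OF c(1)] less.hyps[OF c(2)] less.prems(1) by simp
    qed
    moreover have "divdiff a (S - {k}) (\<lambda>x. 1)
        = divdiff a (S - {l}) (\<lambda>x. 1) + (a l - a k) * divdiff a S (\<lambda>x. 1)"
      using divdiff_cancel_node[OF less.prems(1,2) k, of "\<lambda>x. 1"]
        divdiff_cancel_node[OF less.prems(1,2) l(1), of "\<lambda>x. 1"]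
        divdiff_linear[of a S "\<lambda>x. x - a l" "a l - a k" "\<lambda>x. 1"]
      by simp
    moreover have "a l \<noteq> a k" using k l less.prems by (auto dest: inj_onD)
    ultimately show ?thesis using False by simp
  qed
qed

text \<open>
  The divided difference at \<open>N\<close> nodes is the coefficient of \<open>X ^ (N - 1)\<close> in the interpolating
  polynomial, so a monic polynomial of degree less than \<open>N\<close> gives \<open>1\<close> in degree \<open>N - 1\<close> and \<open>0\<close> below.
\<close>
lemma divdiff_prod_low_degree:
  fixes a :: "'i \<Rightarrow> 'a::field"
  assumes "finite R" "finite S" "inj_on a S" "card R < card S"
  shows "divdiff a S (\<lambda>x. \<Prod>j\<in>R. x - b j) = (if Suc (card R) = card S then 1 else 0)"
  using assms
proof (induction R arbitrary: S rule: finite_induct)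
  case empty
  then have "S \<noteq> {}" by auto
  with empty divdiff_one[of S a] show ?case by auto
next
  case (insert r R)
  obtain k where k: "k \<in> S" using insert.prems by fastforce
  let ?f = "\<lambda>x. \<Prod>j\<in>R. x - b j"
  have "divdiff a S (\<lambda>x. \<Prod>j\<in>insert r R. x - b j)
      = divdiff a S (\<lambda>x. (x - a k) * ?f x + (a k - b r) * ?f x)"
    using insert.hyps by (simp add: algebra_simps)
  also have "\<dots> = divdiff a (S - {k}) ?f + (a k - b r) * divdiff a S ?f"
    unfolding divdiff_linear using divdiff_cancel_node[OF insert.prems(1,2) k] by simp
  also have "divdiff a (S - {k}) ?f = (if Suc (card R) = card (S - {k}) then 1 else 0)"
    using insert.prems insert.hyps k by (intro insert.IH) (auto intro: inj_on_subset)
  also have "divdiff a S ?f = 0"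
    using insert.IH[of S] insert.prems insert.hyps by simp
  finally show ?case using k insert.prems insert.hyps by auto
qed

text \<open>
  In degree equal to the number of nodes, interpolation replaces \<open>\<Prod>j\<in>S. X - b j\<close> by its difference
  with \<open>\<Prod>j\<in>S. X - a j\<close>. The leading terms cancel, and the next coefficient is the difference of
  the root sums.
\<close>
lemma divdiff_prod_same_degree:
  fixes a :: "'i \<Rightarrow> 'a::field"
  assumes "finite S" "inj_on a S"
  shows "divdiff a S (\<lambda>x. \<Prod>j\<in>S. x - b j) = (\<Sum>i\<in>S. a i - b i)"
  using assms
proof (induction S rule: finite_induct)
  case empty
  then show ?case by (simp add: divdiff_def)
next
  case (insert k S)
  let ?f = "\<lambda>x. \<Prod>j\<in>S. x - b j"
  have "divdiff a (insert k S) (\<lambda>x. \<Prod>j\<in>insert k S. x - b j)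
      = divdiff a (insert k S) (\<lambda>x. (x - a k) * ?f x + (a k - b k) * ?f x)"
    using insert.hyps by (simp add: algebra_simps)
  also have "\<dots> = divdiff a S ?f + (a k - b k) * divdiff a (insert k S) ?f"
    unfolding divdiff_linear
    using divdiff_cancel_node[of "insert k S" a k ?f] insert.prems insert.hyps by simp
  also have "divdiff a S ?f = (\<Sum>i\<in>S. a i - b i)"
    using insert by auto
  also have "divdiff a (insert k S) ?f = 1"
    using divdiff_prod_low_degree[of S "insert k S" a b] insert by simp
  finally show ?case using insert.hyps by simp
qed

section \<open>The product formula and its recursion\<close>

lemma shifted_weight_sum:
  assumes "finite D" "0 \<notin> D"
  shows "(\<Sum>x\<in>D. real x * (\<Prod>y\<in>D - {x}.
            ((real x - real y - 1) * (real x + real y)) / ((real x + real y - 1) * (real x - real y))))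
       = (\<Sum>x\<in>D. real x)"
proof -
  \<comment> \<open>\<open>a\<close> is injective on positive integers; \<open>0\<close> and \<open>1\<close> would collide.\<close>
  define a where "a x = real x * (real x - 1)" for x
  define b where "b x = real x * (real x + 1)" for x
  have inj: "inj_on a D"
  proof (rule inj_onI)
    fix x y assume "x \<in> D" "y \<in> D" "a x = a y"
    then have "(real x - real y) * (real x + real y - 1) = 0"
      by (simp add: a_def algebra_simps)
    moreover have "x \<ge> 1" "y \<ge> 1" using \<open>x \<in> D\<close> \<open>y \<in> D\<close> assms by (auto simp: Suc_le_eq intro: Nat.gr0I)
    ultimately show "x = y" by auto
  qed
  have "(\<Sum>x\<in>D. a x - b x) = (\<Sum>x\<in>D. (\<Prod>y\<in>D. a x - b y) / (\<Prod>y\<in>D - {x}. a x - a y))"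
    using divdiff_prod_same_degree[OF assms(1) inj, of b] by (simp add: divdiff_def)
  also have "\<dots> = (\<Sum>x\<in>D. - 2 * (real x * (\<Prod>y\<in>D - {x}.
            ((real x - real y - 1) * (real x + real y)) / ((real x + real y - 1) * (real x - real y)))))"
  proof (rule sum.cong[OF refl])
    fix x assume x: "x \<in> D"
    have "(\<Prod>y\<in>D. a x - b y) = (a x - b x) * (\<Prod>y\<in>D - {x}. a x - b y)"
      using assms x by (intro prod.remove) auto
    moreover have "a x - b x = - 2 * real x" by (simp add: a_def b_def algebra_simps)
    moreover have "a x - b y = (real x - real y - 1) * (real x + real y)"
      and "a x - a y = (real x + real y - 1) * (real x - real y)" for y
      by (simp_all add: a_def b_def algebra_simps)
    ultimately show "(\<Prod>y\<in>D. a x - b y) / (\<Prod>y\<in>D - {x}. a x - a y)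
      = - 2 * (real x * (\<Prod>y\<in>D - {x}.
            ((real x - real y - 1) * (real x + real y)) / ((real x + real y - 1) * (real x - real y))))"
      by (simp add: prod_dividef)
  qed
  also have "\<dots> = - 2 * (\<Sum>x\<in>D. real x * (\<Prod>y\<in>D - {x}.
            ((real x - real y - 1) * (real x + real y)) / ((real x + real y - 1) * (real x - real y))))"
    by (simp add: sum_distrib_left)
  also have "(\<Sum>x\<in>D. a x - b x) = - 2 * (\<Sum>x\<in>D. real x)"
  proof -
    have "a x - b x = - 2 * real x" for x by (simp add: a_def b_def algebra_simps)
    then show ?thesis by (simp only: sum_distrib_left)
  qed
  finally show ?thesis by simp
qed

text \<open>
  A finite set \<open>D\<close> of positive integers stands for the strict partition with these parts. On sets
  the formula needs no indexing, and lowering a part is removing and inserting an element.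
\<close>
definition shifted_tableaux_count :: "nat set \<Rightarrow> real" where
  "shifted_tableaux_count D = fact (\<Sum>D) / (\<Prod>x\<in>D. fact x) *
     (\<Prod>(x, y)\<in>{(x, y). x \<in> D \<and> y \<in> D \<and> y < x}. (real x - real y) / (real x + real y))"

text \<open>
  Absolute values let the factors of the pairs containing \<open>x\<close> be written uniformly, whether the
  other member is smaller or larger than \<open>x\<close>.
\<close>
lemma prod_pairs_insert:
  assumes "finite E" "x \<notin> E"
  shows "(\<Prod>(x, y)\<in>{(x', y). x' \<in> insert x E \<and> y \<in> insert x E \<and> y < x'}.
            (real x - real y) / (real x + real y))
       = (\<Prod>y\<in>E. \<bar>real x - real y\<bar> / (real x + real y)) *
         (\<Prod>(x, y)\<in>{(x, y). x \<in> E \<and> y \<in> E \<and> y < x}. (real x - real y) / (real x + real y))"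
proof -
  let ?f = "\<lambda>(x, y). (real x - real y) / (real x + real y)"
  let ?L = "{y\<in>E. y < x}" and ?U = "{y\<in>E. x < y}"
  let ?E = "{(x, y). x \<in> E \<and> y \<in> E \<and> y < x}"
  have fin: "finite ?E" using finite_subset[of ?E "E \<times> E"] assms by auto
  have "{(x', y). x' \<in> insert x E \<and> y \<in> insert x E \<and> y < x'}
      = (Pair x ` ?L \<union> (\<lambda>y. (y, x)) ` ?U) \<union> ?E"
    using assms by auto
  then have "prod ?f {(x', y). x' \<in> insert x E \<and> y \<in> insert x E \<and> y < x'}
      = prod ?f (Pair x ` ?L) * prod ?f ((\<lambda>y. (y, x)) ` ?U) * prod ?f ?E"
    using assms fin by (simp only:) (subst prod.union_disjoint; (subst prod.union_disjoint)?; force)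
  moreover have "prod ?f (Pair x ` ?L) = (\<Prod>y\<in>?L. \<bar>real x - real y\<bar> / (real x + real y))"
    by (subst prod.reindex) (auto simp: inj_on_def intro!: prod.cong)
  moreover have "prod ?f ((\<lambda>y. (y, x)) ` ?U) = (\<Prod>y\<in>?U. \<bar>real x - real y\<bar> / (real x + real y))"
    by (subst prod.reindex) (auto simp: inj_on_def add.commute intro!: prod.cong)
  moreover have "(\<Prod>y\<in>?L. \<bar>real x - real y\<bar> / (real x + real y)) *
      (\<Prod>y\<in>?U. \<bar>real x - real y\<bar> / (real x + real y)) = (\<Prod>y\<in>E. \<bar>real x - real y\<bar> / (real x + real y))"
  proof -
    have "y < x \<or> x < y" if "y \<in> E" for y
      using that assms by (cases rule: linorder_cases[of x y]) auto
    then have "E = ?L \<union> ?U" by auto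
    moreover have "?L \<inter> ?U = {}" by auto
    ultimately show ?thesis using assms
      by (metis (no_types, lifting) finite_Un prod.union_disjoint)
  qed
  ultimately show ?thesis by simp
qed

lemma shifted_tableaux_count_insert:
  assumes "finite E" "x \<notin> E"
  shows "shifted_tableaux_count (insert x E) = fact (x + \<Sum>E) / (fact x * (\<Prod>y\<in>E. fact y)) *
    ((\<Prod>y\<in>E. \<bar>real x - real y\<bar> / (real x + real y)) *
     (\<Prod>(x, y)\<in>{(x, y). x \<in> E \<and> y \<in> E \<and> y < x}. (real x - real y) / (real x + real y)))"
  using assms unfolding shifted_tableaux_count_def prod_pairs_insert[OF assms] by simp

text \<open>
  A part \<open>0\<close> contributes \<open>1 / 0! = 1\<close> and factors \<open>(y - 0) / (y + 0) = 1\<close>. Hence lowering a part \<open>1\<close>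
  can be treated like lowering any other part.
\<close>
lemma shifted_tableaux_count_remove_zero:
  assumes "finite D"
  shows "shifted_tableaux_count (D - {0}) = shifted_tableaux_count D"
proof (cases "0 \<in> D")
  case True
  have "(\<Prod>y\<in>D - {0}. \<bar>real 0 - real y\<bar> / (real 0 + real y)) = 1"
    by (rule prod.neutral) auto
  moreover have "D = insert 0 (D - {0})" using True by auto
  ultimately show ?thesis
    using shifted_tableaux_count_insert[of "D - {0}" 0] assms
    by (simp add: shifted_tableaux_count_def)
qed simp

text \<open>
  Only the factors involving the lowered part change. The signs work out since
  \<open>x\<close> and \<open>x - 1\<close> lie on the same side of every other part.
\<close>
lemma shifted_tableaux_count_lower_part:
  assumes D: "finite D" "0 \<notin> D" and x: "x \<in> D" "x - 1 \<notin> D"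
  shows "real (\<Sum>D) * shifted_tableaux_count (insert (x - 1) (D - {x}))
    = shifted_tableaux_count D * (real x * (\<Prod>y\<in>D - {x}.
        ((real x - real y - 1) * (real x + real y)) / ((real x + real y - 1) * (real x - real y))))"
proof -
  define E where "E = D - {x}"
  define V where "V = (\<Prod>(x, y)\<in>{(x, y). x \<in> E \<and> y \<in> E \<and> y < x}. (real x - real y) / (real x + real y))"
  define W where "W u = (\<Prod>y\<in>E. \<bar>real u - real y\<bar> / (real u + real y))" for u
  define F :: real where "F = (\<Prod>y\<in>E. fact y)"
  have E: "finite E" "x \<notin> E" "x - 1 \<notin> E" "D = insert x E" using D x by (auto simp: E_def)
  obtain z where z: "x = Suc z" using D x by (cases x) auto
  have "((real x - real y - 1) * (real x + real y)) / ((real x + real y - 1) * (real x - real y))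
      = (\<bar>real z - real y\<bar> / (real z + real y)) / (\<bar>real x - real y\<bar> / (real x + real y))"
    if "y \<in> E" for y
  proof -
    have "y \<noteq> x" "y \<noteq> z" using that E z by auto
    then consider "y < z" | "y > x" using z by linarith
    then have sign: "(real z - real y) / (real x - real y) = \<bar>real z - real y\<bar> / \<bar>real x - real y\<bar>"
    proof cases
      case 1
      then show ?thesis by (simp add: z)
    next
      case 2
      then have "\<bar>real z - real y\<bar> = - (real z - real y)" "\<bar>real x - real y\<bar> = - (real x - real y)"
        by (simp_all add: z)
      then show ?thesis by (simp only: minus_divide_divide)
    qed
    have "((real x - real y - 1) * (real x + real y)) / ((real x + real y - 1) * (real x - real y))
        = (real z - real y) / (real x - real y) * ((real x + real y) / (real z + real y))"
      by (simp add: z mult.commute)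
    also have "\<dots> = (\<bar>real z - real y\<bar> / (real z + real y)) / (\<bar>real x - real y\<bar> / (real x + real y))"
      unfolding sign by (simp add: mult.commute)
    finally show ?thesis .
  qed
  then have ratio: "(\<Prod>y\<in>E. ((real x - real y - 1) * (real x + real y)) / ((real x + real y - 1) * (real x - real y)))
      = W z / W x"
    unfolding W_def prod_dividef[symmetric] by (rule prod.cong[OF refl])
  have Wx: "W x \<noteq> 0"
  proof -
    have "\<bar>real x - real y\<bar> / (real x + real y) \<noteq> 0" if "y \<in> E" for y
    proof -
      have "y \<noteq> x" "0 < x" using that E(2) z by auto
      then show ?thesis by (simp add: add_pos_nonneg less_imp_neq[symmetric])
    qed
    then show ?thesis using E(1) unfolding W_def by (simp only: prod_zero_iff) blast
  qed
  have before: "shifted_tableaux_count D = fact (x + \<Sum>E) / (fact x * F) * (W x * V)"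
    unfolding E(4) V_def F_def W_def using E by (intro shifted_tableaux_count_insert)
  have after: "shifted_tableaux_count (insert (x - 1) E) = fact (z + \<Sum>E) / (fact z * F) * (W z * V)"
    using shifted_tableaux_count_insert[of E z] E z unfolding V_def F_def W_def by simp
  have F: "F \<noteq> 0" using E by (simp add: F_def)
  have sum: "\<Sum>D = Suc (z + \<Sum>E)" using E z by simp
  have "fact (x + \<Sum>E) = real (Suc (z + \<Sum>E)) * fact (z + \<Sum>E)"
    "(fact x :: real) = real x * fact z" "real x \<noteq> 0"
    by (simp_all only: z add_Suc fact_Suc)
  then show ?thesis
    unfolding E_def[symmetric] ratio before after sum using Wx F by simp
qed

lemma shifted_tableaux_count_recursion:
  assumes D: "finite D" "0 \<notin> D" "D \<noteq> {}"
  shows "shifted_tableaux_count D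
    = (\<Sum>x\<in>{x\<in>D. x - 1 \<notin> D}. shifted_tableaux_count (insert (x - 1) (D - {x}) - {0}))"
proof -
  let ?w = "\<lambda>x. real x * (\<Prod>y\<in>D - {x}.
        ((real x - real y - 1) * (real x + real y)) / ((real x + real y - 1) * (real x - real y)))"
  have pos: "\<Sum>D \<noteq> 0" using D by auto
  have "real (\<Sum>D) * (\<Sum>x\<in>{x\<in>D. x - 1 \<notin> D}. shifted_tableaux_count (insert (x - 1) (D - {x}) - {0}))
      = (\<Sum>x\<in>{x\<in>D. x - 1 \<notin> D}. shifted_tableaux_count D * ?w x)"
    unfolding sum_distrib_left
  proof (rule sum.cong[OF refl])
    fix x assume "x \<in> {x\<in>D. x - 1 \<notin> D}"
    then have "x \<in> D" "x - 1 \<notin> D" by auto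
    from shifted_tableaux_count_lower_part[OF D(1,2) this]
    show "real (\<Sum>D) * shifted_tableaux_count (insert (x - 1) (D - {x}) - {0})
        = shifted_tableaux_count D * ?w x"
      using D by (subst shifted_tableaux_count_remove_zero) auto
  qed
  also have "\<dots> = (\<Sum>x\<in>D. shifted_tableaux_count D * ?w x)"
  proof (rule sum.mono_neutral_left)
    \<comment> \<open>A part that cannot be lowered has weight \<open>0\<close>: the factor of \<open>y = x - 1\<close> vanishes.\<close>
    show "\<forall>x\<in>D - {x\<in>D. x - 1 \<notin> D}. shifted_tableaux_count D * ?w x = 0"
    proof
      fix x assume x: "x \<in> D - {x\<in>D. x - 1 \<notin> D}"
      then have "x \<noteq> 0" using D by auto
      then have "x - 1 \<in> D - {x}" "real x - real (x - 1) - 1 = 0" using x by auto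
      then have "(\<Prod>y\<in>D - {x}. ((real x - real y - 1) * (real x + real y)) /
          ((real x + real y - 1) * (real x - real y))) = 0"
        using D by (intro prod_zero) (auto intro!: bexI[of _ "x - 1"])
      then show "shifted_tableaux_count D * ?w x = 0" by simp
    qed
  qed (use D in auto)
  also have "\<dots> = real (\<Sum>D) * shifted_tableaux_count D"
    unfolding sum_distrib_left[symmetric] using shifted_weight_sum[OF D(1,2)] by simp
  finally show ?thesis using pos by (simp only: mult_cancel_left of_nat_eq_0_iff) simp
qed

section \<open>Covers in the poset of paths\<close>

lemma paths_iff: "P \<in> paths n \<longleftrightarrow> length P = n"
  by (simp add: paths_def)

lemma height_0 [simp]: "height P 0 = 0"
  by (simp add: height_def)

lemma height_Suc: "i < length P \<Longrightarrow> height P (Suc i) = height P i + step_val (P ! i)"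
  by (simp add: height_def take_Suc_conv_app_nth)

lemma step_val_inj: "step_val s = step_val t \<Longrightarrow> s = t"
  by (cases s; cases t) auto

lemma step_val_bounds: "step_val s \<le> 1" "- 1 \<le> step_val s"
  by (cases s; simp)+

lemma path_eq_if_heights_eq:
  assumes "length P = n" "length Q = n" "\<And>i. i \<in> {1..n} \<Longrightarrow> height P i = height Q i"
  shows "P = Q"
proof (rule nth_equalityI)
  fix i assume i: "i < length P"
  have "height P i = height Q i" using assms i by (cases "i = 0") auto
  moreover have "height P (Suc i) = height Q (Suc i)" using assms i by auto
  ultimately show "P ! i = Q ! i"
    using i assms by (auto simp: height_Suc intro: step_val_inj)
qed (use assms in simp)

lemma height_parity: "i \<le> length P \<Longrightarrow> even (height P i - int i)"
proof (induction i)
  case (Suc i)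
  then show ?case by (cases "P ! i") (auto simp: height_Suc)
qed simp

text \<open>
  The positions where a path can be raised at a single point: the \<open>d\<close> of a valley \<open>du\<close>, or a final
  \<open>d\<close>.
\<close>
definition raisable :: "step list \<Rightarrow> nat set" where
  "raisable P = {j. j < length P \<and> P ! j = Down \<and> (Suc j < length P \<longrightarrow> P ! Suc j = Up)}"

text \<open>
  Updating a list beyond its end does nothing, so the same formula turns \<open>du\<close> into \<open>ud\<close>
  and a final \<open>d\<close> into \<open>u\<close>.
\<close>
definition raise :: "step list \<Rightarrow> nat \<Rightarrow> step list" where
  "raise P j = P[j := Up, Suc j := Down]"

lemma length_raise [simp]: "length (raise P j) = length P"
  by (simp add: raise_def)

lemma height_raise:
  assumes "j \<in> raisable P" "i \<le> length P"
  shows "height (raise P j) i = height P i + (if i = Suc j then 2 else 0)"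
  using assms(2)
proof (induction i)
  case (Suc i)
  then show ?case using assms(1)
    by (auto simp: height_Suc raise_def raisable_def nth_list_update)
qed simp

text \<open>
  Among the points where \<open>P\<close> is strictly below \<open>Q\<close>, one where \<open>P\<close> is lowest must be a valley or the
  end of a final downstep of \<open>P\<close>: otherwise a neighbouring point of \<open>P\<close> would be lower still, and
  \<open>Q\<close>, which changes height by \<open>1\<close> per step, could not have come down to it. By parity \<open>Q\<close> is at
  least \<open>2\<close> higher there, which leaves room for the raised path.
\<close>
lemma raise_below:
  assumes "P \<in> paths n" "Q \<in> paths n" "path_less n P Q"
  obtains j where "j \<in> raisable P" "path_le n (raise P j) Q"
proof -
  have len: "length P = n" "length Q = n" using assms by (auto simp: paths_iff)
  have le: "height P i \<le> height Q i" if "i \<le> n" for i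
    using assms that by (cases "i = 0") (auto simp: path_less_def path_le_def)
  define T where "T = {i\<in>{1..n}. height P i < height Q i}"
  have "T \<noteq> {}"
    using path_eq_if_heights_eq[OF len] assms le
    unfolding T_def path_less_def by force
  moreover have "finite T" by (simp add: T_def)
  ultimately obtain t where t: "t \<in> T" "\<And>i. i \<in> T \<Longrightarrow> height P t \<le> height P i"
    using that[of "arg_min_on (height P) T"] arg_min_if_finite(1)[of T "height P"]
      arg_min_least[of T _ "height P"] by blast
  then obtain j where j: "t = Suc j" "j < n" by (cases t) (auto simp: T_def)
  have lt: "height P (Suc j) < height Q (Suc j)" using t j by (simp add: T_def)
  have minj: "height P (Suc j) \<le> height P i" if "i \<le> n" "height P i < height Q i" for i
    using t(2)[of i] that j by (cases "i = 0") (auto simp: T_def)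
  have "P ! j = Down"
  proof (rule ccontr)
    assume "P ! j \<noteq> Down"
    then have "P ! j = Up" by (cases "P ! j") auto
    then show False
      using lt minj[of j] step_val_bounds[of "Q ! j"] len j by (simp add: height_Suc)
  qed
  moreover have "P ! Suc j = Up" if "Suc j < n"
  proof (rule ccontr)
    assume "P ! Suc j \<noteq> Up"
    then have "P ! Suc j = Down" by (cases "P ! Suc j") auto
    then show False
      using lt minj[of "Suc (Suc j)"] step_val_bounds[of "Q ! Suc j"] len that
        height_Suc[of "Suc j" P] height_Suc[of "Suc j" Q] by simp
  qed
  ultimately have r: "j \<in> raisable P" using len j by (simp add: raisable_def)
  have "height P (Suc j) + 2 \<le> height Q (Suc j)"
    using height_parity[of "Suc j" P] height_parity[of "Suc j" Q] len j lt by (simp; presburger)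
  then have "path_le n (raise P j) Q"
    using le len unfolding path_le_def by (auto simp: height_raise[OF r])
  with r show ?thesis using that by blast
qed

lemma path_less_raise:
  assumes "P \<in> paths n" "j \<in> raisable P"
  shows "path_less n P (raise P j)"
proof -
  have "Suc j \<le> length P" using assms by (simp add: raisable_def)
  then have "height (raise P j) (Suc j) \<noteq> height P (Suc j)"
    using height_raise[OF assms(2), of "Suc j"] by simp
  then have "P \<noteq> raise P j" by metis
  then show ?thesis
    using assms height_raise[OF assms(2)] by (auto simp: path_less_def path_le_def paths_iff)
qed

text \<open>
  A cover must be a raised path because some raised path lies weakly below it. Conversely a raised path
  differs from \<open>P\<close> in a single height, by \<open>2\<close>, and parity excludes the value in between.
\<close>
lemma covered_by_iff_raise:
  assumes P: "P \<in> paths n"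
  shows "covered_by n P Q \<longleftrightarrow> Q \<in> raise P ` raisable P"
proof
  assume c: "covered_by n P Q"
  then have Q: "Q \<in> paths n" "path_less n P Q" by (auto simp: covered_by_def)
  obtain j where j: "j \<in> raisable P" "path_le n (raise P j) Q"
    using raise_below[OF P Q] .
  have "raise P j \<in> paths n" using P by (simp add: paths_iff)
  then have "raise P j = Q"
    using c j path_less_raise[OF P j(1)] by (auto simp: covered_by_def path_less_def)
  then show "Q \<in> raise P ` raisable P" using j by auto
next
  assume "Q \<in> raise P ` raisable P"
  then obtain j where j: "j \<in> raisable P" "Q = raise P j" by auto
  have len: "length P = n" using P by (simp add: paths_iff)
  have False if R: "R \<in> paths n" "path_less n P R" "path_less n R Q" for R
  proof -
    have lenR: "length R = n" using R by (simp add: paths_iff)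
    have b: "height P i \<le> height R i" "height R i \<le> height P i + (if i = Suc j then 2 else 0)"
      if "i \<in> {1..n}" for i
    proof -
      show "height P i \<le> height R i" using R that by (simp add: path_less_def path_le_def)
      have "height R i \<le> height Q i" using R that by (simp add: path_less_def path_le_def)
      then show "height R i \<le> height P i + (if i = Suc j then 2 else 0)"
        using height_raise[OF j(1), of i] that j len by simp
    qed
    have sj: "Suc j \<in> {1..n}" using j len by (auto simp: raisable_def)
    have "height R (Suc j) = height P (Suc j) \<or> height R (Suc j) = height P (Suc j) + 2"
      using b[OF sj] height_parity[of "Suc j" P] height_parity[of "Suc j" R] len lenR sj
      by (simp; presburger)
    then show False
    proof
      assume "height R (Suc j) = height P (Suc j)"
      then have "R = P" using b by (intro path_eq_if_heights_eq[OF lenR len]) (force split: if_splits)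
      then show False using R by (simp add: path_less_def)
    next
      assume *: "height R (Suc j) = height P (Suc j) + 2"
      have "R = Q"
      proof (rule path_eq_if_heights_eq[OF lenR])
        show "length Q = n" using j len by simp
        fix i assume i: "i \<in> {1..n}"
        show "height R i = height Q i"
          using b[OF i] * height_raise[OF j(1), of i] i len j by (cases "i = Suc j") auto
      qed
      then show False using R by (simp add: path_less_def)
    qed
  qed
  then show "covered_by n P Q"
    using P j path_less_raise[OF P j(1)] by (auto simp: covered_by_def paths_iff)
qed

section \<open>Chains as lowerings of depths\<close>

definition down_depths :: "step list \<Rightarrow> nat set" where
  "down_depths P = {length P - j | j. j < length P \<and> P ! j = Down}"

lemma down_depths_iff:
  "x \<in> down_depths P \<longleftrightarrow> 1 \<le> x \<and> x \<le> length P \<and> P ! (length P - x) = Down"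
proof
  assume x: "1 \<le> x \<and> x \<le> length P \<and> P ! (length P - x) = Down"
  then show "x \<in> down_depths P"
    unfolding down_depths_def by (intro CollectI exI[of _ "length P - x"]) auto
qed (auto simp: down_depths_def)

lemma finite_down_depths: "finite (down_depths P)"
  by (rule finite_subset[of _ "{..length P}"]) (auto simp: down_depths_iff)

lemma zero_notin_down_depths: "0 \<notin> down_depths P"
  by (simp add: down_depths_iff)

lemma down_depths_raise:
  assumes "j \<in> raisable P"
  shows "down_depths (raise P j)
    = insert (length P - j - 1) (down_depths P - {length P - j}) - {0}"
proof -
  have j: "j < length P" using assms by (simp add: raisable_def)
  have "x \<in> down_depths (raise P j) \<longleftrightarrow>
      x \<in> insert (length P - j - 1) (down_depths P - {length P - j}) - {0}" for x
  proof (cases "1 \<le> x \<and> x \<le> length P")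
    case True
    then have "length P - x = j \<longleftrightarrow> x = length P - j"
      "length P - x = Suc j \<longleftrightarrow> x = length P - j - 1" using j by auto
    then show ?thesis using assms True
      by (auto simp: down_depths_iff raise_def nth_list_update raisable_def)
  qed (use j in \<open>auto simp: down_depths_iff\<close>)
  then show ?thesis by blast
qed

text \<open>
  The step following one of depth \<open>x\<close> has depth \<open>x - 1\<close>; no step has depth \<open>0\<close>, so the case of a
  final downstep needs no separate treatment.
\<close>
lemma bij_raisable_depths:
  "bij_betw (\<lambda>j. length P - j) (raisable P) {x \<in> down_depths P. x - 1 \<notin> down_depths P}"
proof (rule bij_betw_byWitness[where f' = "\<lambda>x. length P - x"])
  show "(\<lambda>j. length P - j) ` raisable P \<subseteq> {x \<in> down_depths P. x - 1 \<notin> down_depths P}"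
    by (auto simp: raisable_def down_depths_iff)
  show "(\<lambda>x. length P - x) ` {x \<in> down_depths P. x - 1 \<notin> down_depths P} \<subseteq> raisable P"
  proof clarify
    fix x assume x: "x \<in> down_depths P" "x - 1 \<notin> down_depths P"
    then have "Suc (length P - x) = length P - (x - 1)" by (auto simp: down_depths_iff)
    then show "length P - x \<in> raisable P" using x
      by (cases "P ! (length P - (x - 1))") (auto simp: raisable_def down_depths_iff)
  qed
qed (auto simp: raisable_def down_depths_iff)

lemma down_depths_empty_iff: "down_depths P = {} \<longleftrightarrow> P = top_path (length P)"
proof
  assume e: "down_depths P = {}"
  show "P = top_path (length P)"
  proof (rule nth_equalityI)
    fix i assume "i < length P"
    then have "P ! i \<noteq> Down" using e by (auto simp: down_depths_def)
    then show "P ! i = top_path (length P) ! i"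
      using \<open>i < length P\<close> by (cases "P ! i") (auto simp: top_path_def)
  qed (simp add: top_path_def)
next
  assume a: "P = top_path (length P)"
  have "P ! j = Up" if "j < length P" for j
    using that by (subst a) (simp add: top_path_def)
  then show "down_depths P = {}" by (auto simp: down_depths_def)
qed

lemma sum_down_depths_raise:
  assumes "j \<in> raisable P"
  shows "\<Sum>(down_depths (raise P j)) < \<Sum>(down_depths P)"
proof -
  let ?D = "down_depths P" and ?x = "length P - j"
  have x: "?x \<in> ?D" "?x - 1 \<notin> ?D"
    using bij_betw_apply[OF bij_raisable_depths assms] by auto
  have "\<Sum>(down_depths (raise P j)) \<le> \<Sum>(insert (?x - 1) (?D - {?x}))"
    unfolding down_depths_raise[OF assms] by (intro sum_mono2) (auto simp: finite_down_depths)
  also have "\<dots> = (?x - 1) + \<Sum>(?D - {?x})"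
    using x by (simp add: finite_down_depths)
  also have "\<dots> < ?x + \<Sum>(?D - {?x})"
  proof -
    have "0 < ?x" using assms by (simp add: raisable_def)
    then show ?thesis by linarith
  qed
  also have "\<dots> = \<Sum>?D" using x finite_down_depths by (metis sum.remove)
  finally show ?thesis .
qed

lemma saturated_chains_refl_top:
  "saturated_chains n (top_path n) (top_path n) = {[top_path n]}"
proof -
  have top: "top_path n \<in> paths n" by (simp add: paths_iff top_path_def)
  have no: "raisable (top_path n) = {}" by (auto simp: raisable_def top_path_def)
  have "c = [top_path n]" if c: "c \<in> saturated_chains n (top_path n) (top_path n)" for c
  proof (cases c)
    case (Cons x d)
    have "d = []"
    proof (rule ccontr)
      assume "d \<noteq> []"
      then have "covered_by n (c ! 0) (c ! 1)"
        using c Cons by (auto simp: saturated_chains_def)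
      then show False using c Cons covered_by_iff_raise[OF top] no
        by (simp add: saturated_chains_def)
    qed
    then show ?thesis using c Cons by (auto simp: saturated_chains_def)
  qed (use c in \<open>simp add: saturated_chains_def\<close>)
  then show ?thesis using top by (auto simp: saturated_chains_def)
qed

lemma saturated_chains_step:
  assumes "P \<in> paths n" "P \<noteq> Q"
  shows "saturated_chains n P Q = (\<Union>j\<in>raisable P. (#) P ` saturated_chains n (raise P j) Q)"
proof (intro equalityI subsetI)
  fix c assume c: "c \<in> saturated_chains n P Q"
  then obtain d where d: "c = P # d" by (cases c) (auto simp: saturated_chains_def)
  with c assms have "d \<noteq> []" by (auto simp: saturated_chains_def)
  then have "covered_by n (c ! 0) (c ! 1)" using c d by (auto simp: saturated_chains_def)
  then have "covered_by n P (hd d)" using d \<open>d \<noteq> []\<close> by (simp add: hd_conv_nth)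
  then obtain j where j: "j \<in> raisable P" "hd d = raise P j"
    using covered_by_iff_raise[OF assms(1)] by auto
  have "covered_by n (d ! i) (d ! Suc i)" if "Suc i < length d" for i
  proof -
    have "covered_by n (c ! Suc i) (c ! Suc (Suc i))"
      using c that d unfolding saturated_chains_def by (auto simp del: nth_Cons_Suc)
    then show ?thesis using d by simp
  qed
  then have "d \<in> saturated_chains n (raise P j) Q"
    using c d j \<open>d \<noteq> []\<close> by (auto simp: saturated_chains_def)
  then show "c \<in> (\<Union>j\<in>raisable P. (#) P ` saturated_chains n (raise P j) Q)"
    using d j by auto
next
  fix c assume "c \<in> (\<Union>j\<in>raisable P. (#) P ` saturated_chains n (raise P j) Q)"
  then obtain j d where j: "j \<in> raisable P" and d: "d \<in> saturated_chains n (raise P j) Q"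
    and c: "c = P # d" by auto
  have "covered_by n P (raise P j)" using covered_by_iff_raise[OF assms(1)] j by auto
  then have "covered_by n (c ! i) (c ! Suc i)" if "Suc i < length c" for i
    using that d c by (cases i) (auto simp: saturated_chains_def hd_conv_nth[symmetric])
  then show "c \<in> saturated_chains n P Q"
    using d c assms by (auto simp: saturated_chains_def)
qed

text \<open>
  Each raise lowers the sum of the depths, which makes the recursion of the chains over their
  second element well-founded. Finiteness is carried along since a sum of cardinalities counts a
  union only when its members are finite.
\<close>
lemma card_saturated_chains_to_top:
  assumes "P \<in> paths n"
  shows "finite (saturated_chains n P (top_path n)) \<and>
    real (card (saturated_chains n P (top_path n))) = shifted_tableaux_count (down_depths P)"
  using assms
proof (induction "\<Sum>(down_depths P)" arbitrary: P rule: less_induct)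
  case less
  have len: "length P = n" using less.prems by (simp add: paths_iff)
  show ?case
  proof (cases "P = top_path n")
    case True
    then have "down_depths P = {}" unfolding down_depths_empty_iff len .
    then show ?thesis using True
      by (simp add: saturated_chains_refl_top shifted_tableaux_count_def)
  next
    case False
    let ?C = "\<lambda>P. saturated_chains n P (top_path n)"
    have ne: "down_depths P \<noteq> {}" using False unfolding down_depths_empty_iff len .
    have IH: "finite (?C (raise P j))"
      "real (card (?C (raise P j))) = shifted_tableaux_count (down_depths (raise P j))"
      if "j \<in> raisable P" for j
      using less.hyps[OF sum_down_depths_raise[OF that]] less.prems by (auto simp: paths_iff)
    have fin: "finite (raisable P)" by (simp add: raisable_def)
    have inj: "raise P j = raise P j' \<Longrightarrow> j = j'" if "j \<in> raisable P" "j' \<in> raisable P" for j j'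
      using height_raise[OF that(1), of "Suc j"] height_raise[OF that(2), of "Suc j"] that
      by (auto simp: raisable_def split: if_splits)
    have eq: "?C P = (\<Union>j\<in>raisable P. (#) P ` ?C (raise P j))"
      using saturated_chains_step[OF less.prems False] .
    have "card (?C P) = (\<Sum>j\<in>raisable P. card ((#) P ` ?C (raise P j)))"
      unfolding eq
    proof (rule card_UN_disjoint)
      show "\<forall>i\<in>raisable P. \<forall>j\<in>raisable P. i \<noteq> j \<longrightarrow>
          (#) P ` ?C (raise P i) \<inter> (#) P ` ?C (raise P j) = {}"
        using inj by (fastforce simp: saturated_chains_def)
    qed (use fin IH in auto)
    also have "\<dots> = (\<Sum>j\<in>raisable P. card (?C (raise P j)))"
      by (simp add: card_image)
    finally have "real (card (?C P)) = (\<Sum>j\<in>raisable P. shifted_tableaux_count (down_depths (raise P j)))"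
      using IH by simp
    also have "\<dots> = (\<Sum>j\<in>raisable P. shifted_tableaux_count
        (insert (length P - j - 1) (down_depths P - {length P - j}) - {0}))"
      by (simp add: down_depths_raise)
    also have "\<dots> = (\<Sum>x\<in>{x\<in>down_depths P. x - 1 \<notin> down_depths P}.
        shifted_tableaux_count (insert (x - 1) (down_depths P - {x}) - {0}))"
      by (rule sum.reindex_bij_betw[OF bij_raisable_depths])
    also have "\<dots> = shifted_tableaux_count (down_depths P)"
      using shifted_tableaux_count_recursion[OF finite_down_depths zero_notin_down_depths ne] by simp
    finally show ?thesis using eq fin IH by simp
  qed
qed

section \<open>Downsteps listed from left to right\<close>

definition down_positions :: "step list \<Rightarrow> nat set" where
  "down_positions P = {j. j < length P \<and> P ! j = Down}"

lemma card_down_positions: "card (down_positions P) = count_list P Down"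
  by (simp add: down_positions_def count_list_eq_length_filter length_filter_conv_card
      eq_commute[of Down])

lemma down_index_strict_mono_bij:
  shows "strict_mono_on {1..count_list P Down} (down_index P)"
    and "bij_betw (down_index P) {1..count_list P Down} (down_positions P)"
proof -
  define L where "L = filter (\<lambda>j. P ! j = Down) [0..<length P]"
  have setL: "set L = down_positions P" by (auto simp: L_def down_positions_def)
  have "distinct L" by (simp add: L_def)
  then have lenL: "length L = count_list P Down"
    using setL distinct_card[of L] card_down_positions by simp
  have sorted: "sorted_wrt (<) L" by (simp add: L_def sorted_wrt_filter)
  have nth: "down_index P i = L ! (i - 1)" for i by (simp add: L_def down_index_def)
  show mono: "strict_mono_on {1..count_list P Down} (down_index P)"
  proof (rule strict_mono_onI)
    fix r s assume "r \<in> {1..count_list P Down}" "s \<in> {1..count_list P Down}" "r < s"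
    then show "down_index P r < down_index P s"
      unfolding nth using lenL by (intro sorted_wrt_nth_less[OF sorted]) auto
  qed
  have "down_index P ` {1..count_list P Down} \<subseteq> down_positions P"
    unfolding setL[symmetric] nth using lenL by (auto intro!: nth_mem)
  moreover have "inj_on (down_index P) {1..count_list P Down}"
    using mono by (rule strict_mono_on_imp_inj_on)
  moreover have "finite (down_positions P)" by (simp add: down_positions_def)
  ultimately show "bij_betw (down_index P) {1..count_list P Down} (down_positions P)"
    by (simp add: bij_betw_def card_subset_eq card_image card_down_positions)
qed

text \<open>
  Of the steps before the \<open>i\<close>-th downstep, exactly \<open>i - 1\<close> are downsteps. This makes
  \<open>n - i - k\<^sub>i + 1\<close> the depth of that downstep.
\<close>
lemma ups_before_down_eq:
  assumes i: "i \<in> {1..count_list P Down}"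
  shows "ups_before_down P i + (i - 1) = down_index P i"
proof -
  let ?q = "down_index P i"
  note mono = down_index_strict_mono_bij(1)[of P] and bij = down_index_strict_mono_bij(2)[of P]
  have q: "?q < length P" using bij_betw_apply[OF bij i] by (simp add: down_positions_def)
  have "down_positions (take ?q P) = {j \<in> down_positions P. j < ?q}"
    using q by (auto simp: down_positions_def)
  also have "\<dots> = down_index P ` {1..<i}"
  proof (intro equalityI subsetI)
    fix j assume j: "j \<in> {j \<in> down_positions P. j < ?q}"
    then obtain l where l: "l \<in> {1..count_list P Down}" "j = down_index P l"
      using bij by (metis (no_types, lifting) bij_betw_imp_surj_on imageE mem_Collect_eq)
    then have "l < i" using j strict_mono_on_less[OF mono l(1) i] by simp
    then show "j \<in> down_index P ` {1..<i}" using l by auto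
  next
    fix j assume "j \<in> down_index P ` {1..<i}"
    then obtain l where l: "l \<in> {1..<i}" "j = down_index P l" by auto
    then have l': "l \<in> {1..count_list P Down}" using i by auto
    then have "j < ?q" using l strict_mono_on_less[OF mono l' i] by simp
    then show "j \<in> {j \<in> down_positions P. j < ?q}"
      using bij_betw_apply[OF bij l'] l by simp
  qed
  finally have "card (down_positions (take ?q P)) = card {1..<i}"
    using inj_on_subset[OF bij_betw_imp_inj_on[OF bij], of "{1..<i}"] i by (simp add: card_image subset_iff)
  then have "count_list (take ?q P) Down = i - 1" by (simp add: card_down_positions)
  moreover have "count_list xs Up + count_list xs Down = length xs" for xs
  proof (induction xs)
    case (Cons s xs)
    then show ?case by (cases s) auto
  qed simp
  from this[of "take ?q P"] have "count_list (take ?q P) Up + count_list (take ?q P) Down = ?q"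
    using q by simp
  ultimately show ?thesis by (simp add: ups_before_down_def)
qed

text \<open>
  The parts being listed in decreasing order, the pairs \<open>i < j\<close> correspond to the pairs of parts
  with the larger one first.
\<close>
lemma shifted_tableaux_count_reindex:
  fixes l :: "nat \<Rightarrow> nat"
  assumes bij: "bij_betw l {1..m} D"
    and anti: "\<And>i j. i \<in> {1..m} \<Longrightarrow> j \<in> {1..m} \<Longrightarrow> i < j \<Longrightarrow> l j < l i"
  shows "shifted_tableaux_count D = fact (\<Sum>i=1..m. l i) / (\<Prod>i=1..m. fact (l i)) *
    (\<Prod>(i, j)\<in>{(i, j). 1 \<le> i \<and> i < j \<and> j \<le> m}.
       (real (l i) - real (l j)) / (real (l i) + real (l j)))"
proof -
  let ?I = "{(i, j). 1 \<le> i \<and> i < j \<and> j \<le> m}"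
  let ?l = "\<lambda>(i, j). (l i, l j)"
  have less_iff: "l j < l i \<longleftrightarrow> i < j" if "i \<in> {1..m}" "j \<in> {1..m}" for i j
    using anti[of i j] anti[of j i] that by (cases i j rule: linorder_cases) auto
  have D: "D = l ` {1..m}" and inj: "inj_on l {1..m}" using bij by (auto simp: bij_betw_def)
  have "{(x, y). x \<in> D \<and> y \<in> D \<and> y < x} = ?l ` ?I"
  proof (intro equalityI subsetI)
    fix p assume "p \<in> {(x, y). x \<in> D \<and> y \<in> D \<and> y < x}"
    then obtain i j where "i \<in> {1..m}" "j \<in> {1..m}" "p = (l i, l j)" "l j < l i"
      unfolding D by auto
    then show "p \<in> ?l ` ?I" using less_iff[of i j] by auto
  next
    fix p assume "p \<in> ?l ` ?I"
    then obtain i j where "1 \<le> i" "i < j" "j \<le> m" "p = (l i, l j)" by auto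
    then show "p \<in> {(x, y). x \<in> D \<and> y \<in> D \<and> y < x}"
      using less_iff[of i j] unfolding D by simp
  qed
  moreover have "inj_on ?l ?I"
    by (rule inj_onI) (auto dest: inj_onD[OF inj])
  ultimately have "(\<Prod>(x, y)\<in>{(x, y). x \<in> D \<and> y \<in> D \<and> y < x}. (real x - real y) / (real x + real y))
      = (\<Prod>(i, j)\<in>?I. (real (l i) - real (l j)) / (real (l i) + real (l j)))"
    by (simp add: prod.reindex case_prod_unfold comp_def)
  moreover have "\<Sum>D = (\<Sum>i=1..m. l i)" "(\<Prod>x\<in>D. fact x :: real) = (\<Prod>i=1..m. fact (l i))"
    unfolding D using inj by (simp_all add: sum.reindex prod.reindex)
  ultimately show ?thesis by (simp add: shifted_tableaux_count_def)
qed

theorem corollary8: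
  fixes n m :: nat and P :: "step list" and k lam :: "nat \<Rightarrow> nat"
  assumes "P \<in> paths n - {top_path n}"
    and "m = count_list P Down"
    and "\<And>i. i \<in> {1..m} \<Longrightarrow> k i = ups_before_down P i"
    and "\<And>i. i \<in> {1..m} \<Longrightarrow> lam i = n - i - k i + 1"
  shows "real (card (saturated_chains n P (top_path n))) =
    fact (\<Sum>i=1..m. lam i) / (\<Prod>i=1..m. fact (lam i)) *
    (\<Prod>(i, j)\<in>{(i, j). 1 \<le> i \<and> i < j \<and> j \<le> m}.
       (real (lam i) - real (lam j)) / (real (lam i) + real (lam j)))"
proof -
  have P: "P \<in> paths n" and len: "length P = n" using assms(1) by (auto simp: paths_iff)
  note mono = down_index_strict_mono_bij(1)[of P, folded assms(2)]
    and bij = down_index_strict_mono_bij(2)[of P, folded assms(2)]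
  have idx: "down_index P i < n" if "i \<in> {1..m}" for i
    using bij_betw_apply[OF bij that] len by (simp add: down_positions_def)
  have lam: "lam i = n - down_index P i" if i: "i \<in> {1..m}" for i
    using assms(3,4)[OF i] idx[OF i] ups_before_down_eq[of i P] i assms(2) by auto
  have "bij_betw (\<lambda>j. n - j) (down_positions P) (down_depths P)"
    unfolding bij_betw_def inj_on_def down_depths_def down_positions_def len
    by (auto simp: setcompr_eq_image)
  from bij_betw_trans[OF bij this] have "bij_betw lam {1..m} (down_depths P)"
    by (rule bij_betw_cong[THEN iffD1, rotated]) (simp add: lam)
  moreover have "lam j < lam i" if "i \<in> {1..m}" "j \<in> {1..m}" "i < j" for i j
    using strict_mono_onD[OF mono that] idx[of j] that by (simp add: lam diff_less_mono2)
  ultimately have "shifted_tableaux_count (down_depths P) =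
    fact (\<Sum>i=1..m. lam i) / (\<Prod>i=1..m. fact (lam i)) *
    (\<Prod>(i, j)\<in>{(i, j). 1 \<le> i \<and> i < j \<and> j \<le> m}.
       (real (lam i) - real (lam j)) / (real (lam i) + real (lam j)))"
    by (rule shifted_tableaux_count_reindex)
  then show ?thesis using card_saturated_chains_to_top[OF P] by simp
qed

end
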